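(* Let $x,y,z$ be independent indeterminates. Consider the initial triple $(x,y,z)$, along with every triple of rational functions in $x$, $y$, and $z$ that can be obtained from the initial triple by a finite sequence of operations of the form $$(X,Y,Z)\mapsto(X',Y,Z),\qquad (X,Y,Z)\mapsto(X,Y',Z),\qquad\text{or}\qquad (X,Y,Z)\mapsto(X,Y,Z'),$$ where $$X'=\frac{Y^2+Z^2}{X},\qquad Y'=\frac{X^2+Z^2}{Y},\qquad Z'=\frac{X^2+Y^2}{Z}.$$ Then every rational function of $x$, $y$, and $z$ that occurs in such a triple is a Laurent polynomial in $x,y,z$ with positive coefficients.
   Context: A Laurent polynomial with positive coefficients in $x,y,z$ is a rational function that can be written as a finite linear combination of monomials $x^ay^bz^c$ with $a,b,c\in\mathbf{Z}$ (possibly negative), all of whose non-zero coefficients are positive. *)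

theory Defs
  imports "HOL-Computational_Algebra.Polynomial" "HOL-Computational_Algebra.Fraction_Field"
begin

text \<open>
  The field $K(x,y,z)$ of rational functions in three independent indeterminates is the fraction
  field of the iterated polynomial ring $K[x][y][z]$.  The indeterminate $x$ belongs to the
  innermost polynomial ring, $z$ to the outermost one.
\<close>

type_synonym 'a ratfun = "'a poly poly poly fract"

definition ratconst :: "'a::field \<Rightarrow> 'a ratfun" where
  "ratconst c = Fract [:[:[:c:]:]:] 1"

definition var_x :: "'a::field ratfun" where
  "var_x = Fract [:[:[:0, 1:]:]:] 1"

definition var_y :: "'a::field ratfun" where
  "var_y = Fract [:[:0, 1:]:] 1"

definition var_z :: "'a::field ratfun" where
  "var_z = Fract [:0, 1:] 1"

definition laurent_monomial :: "int \<times> int \<times> int \<Rightarrow> 'a::field ratfun" where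
  "laurent_monomial = (\<lambda>(a, b, c). var_x powi a * var_y powi b * var_z powi c)"

text \<open>
  The finite set \<open>S\<close> lists pairwise distinct exponent vectors, so \<open>k m\<close> is the coefficient of
  the monomial with exponent vector \<open>m\<close>.
\<close>

definition positive_laurent :: "'a::linordered_field ratfun \<Rightarrow> bool" where
  "positive_laurent f \<longleftrightarrow>
     (\<exists>S k. finite S \<and> (\<forall>m\<in>S. k m \<noteq> 0 \<longrightarrow> k m > 0) \<and>
        f = (\<Sum>m\<in>S. ratconst (k m) * laurent_monomial m))"

text \<open>
  Division in \<^typ>\<open>'a ratfun\<close> is total, with quotients by \<open>0\<close> equal to \<open>0\<close>.  This convention is
  never used below: the triples are built from \<open>x, y, z\<close> by addition, multiplication and division
  only, so over an ordered field all their components take positive values at $x = y = z = 1$.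
\<close>

inductive markoff_triple ::
  "'a::linordered_field ratfun \<Rightarrow> 'a ratfun \<Rightarrow> 'a ratfun \<Rightarrow> bool" where
  initial: "markoff_triple var_x var_y var_z"
| step_X: "markoff_triple X Y Z \<Longrightarrow> markoff_triple ((Y\<^sup>2 + Z\<^sup>2) / X) Y Z"
| step_Y: "markoff_triple X Y Z \<Longrightarrow> markoff_triple X ((X\<^sup>2 + Z\<^sup>2) / Y) Z"
| step_Z: "markoff_triple X Y Z \<Longrightarrow> markoff_triple X Y ((X\<^sup>2 + Y\<^sup>2) / Z)"

end

theory Submission
  imports Defs "HOL-Library.Multiset" "HOL-Library.Product_Plus"
begin

text \<open>
  The quantity $K = (x^2+y^2+z^2)/(xyz)$ is invariant under the three operations, which therefore
  read $X' = KYZ - X$, and so on.  In the part of the tree of triples that begins with the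
  replacement of one initial variable, triples have the form $(P_{12}, (PQ)_{12}, Q_{12})$ for
  matrices $P, Q$ of determinant $1$ all of whose products $M$ that occur satisfy
  $\mathrm{tr}\, M = K M_{12}$ (Cohn matrices): by Cayley--Hamilton,
  $P^2 Q = (\mathrm{tr}\, P)\, PQ - Q$, so passing from $(P,Q)$ to $(P,PQ)$ or $(PQ,Q)$ is one
  operation on triples.  All these matrices are products of two initial ones, which can be chosen
  with entries that are Laurent polynomials with positive coefficients.
\<close>

section \<open>Two-by-two matrices, Cayley-Hamilton recursions and Cohn pairs\<close>

datatype 'a mat2 = Mat (e11: 'a) (e12: 'a) (e21: 'a) (e22: 'a)

definition mat2_mult :: "'a::comm_ring_1 mat2 \<Rightarrow> 'a mat2 \<Rightarrow> 'a mat2" (infixl \<open>\<odot>\<close> 70) where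
  "P \<odot> Q = Mat (e11 P * e11 Q + e12 P * e21 Q) (e11 P * e12 Q + e12 P * e22 Q)
                 (e21 P * e11 Q + e22 P * e21 Q) (e21 P * e12 Q + e22 P * e22 Q)"

lemma mat2_mult_simps [simp]:
  "e11 (P \<odot> Q) = e11 P * e11 Q + e12 P * e21 Q"
  "e12 (P \<odot> Q) = e11 P * e12 Q + e12 P * e22 Q"
  "e21 (P \<odot> Q) = e21 P * e11 Q + e22 P * e21 Q"
  "e22 (P \<odot> Q) = e21 P * e12 Q + e22 P * e22 Q"
  by (simp_all add: mat2_mult_def)

definition mat2_det :: "'a::comm_ring_1 mat2 \<Rightarrow> 'a" where
  "mat2_det P = e11 P * e22 P - e12 P * e21 P"

definition mat2_tr :: "'a::comm_ring_1 mat2 \<Rightarrow> 'a" where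
  "mat2_tr P = e11 P + e22 P"

lemma mat2_det_mult: "mat2_det (P \<odot> Q) = mat2_det P * mat2_det Q"
  by (simp add: mat2_det_def algebra_simps)

lemma mat2_square_mult_left:
  assumes "mat2_det P = 1"
  shows "e12 (P \<odot> (P \<odot> Q)) = mat2_tr P * e12 (P \<odot> Q) - e12 Q"
    and "mat2_tr (P \<odot> (P \<odot> Q)) = mat2_tr P * mat2_tr (P \<odot> Q) - mat2_tr Q"
proof -
  \<comment> \<open>As long as \<open>mat2_det P\<close> is not replaced by 1, both equations are
    polynomial identities in the entries.\<close>
  have "e12 (P \<odot> (P \<odot> Q)) = mat2_tr P * e12 (P \<odot> Q) - mat2_det P * e12 Q"
    and "mat2_tr (P \<odot> (P \<odot> Q)) = mat2_tr P * mat2_tr (P \<odot> Q) - mat2_det P * mat2_tr Q"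
    by (simp_all add: mat2_det_def mat2_tr_def algebra_simps)
  then show "e12 (P \<odot> (P \<odot> Q)) = mat2_tr P * e12 (P \<odot> Q) - e12 Q"
    and "mat2_tr (P \<odot> (P \<odot> Q)) = mat2_tr P * mat2_tr (P \<odot> Q) - mat2_tr Q"
    by (simp_all only: assms mult_1)
qed

lemma mat2_square_mult_right:
  assumes "mat2_det Q = 1"
  shows "e12 ((P \<odot> Q) \<odot> Q) = mat2_tr Q * e12 (P \<odot> Q) - e12 P"
    and "mat2_tr ((P \<odot> Q) \<odot> Q) = mat2_tr Q * mat2_tr (P \<odot> Q) - mat2_tr P"
proof -
  have "e12 ((P \<odot> Q) \<odot> Q) = mat2_tr Q * e12 (P \<odot> Q) - mat2_det Q * e12 P"
    and "mat2_tr ((P \<odot> Q) \<odot> Q) = mat2_tr Q * mat2_tr (P \<odot> Q) - mat2_det Q * mat2_tr P"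
    by (simp_all add: mat2_det_def mat2_tr_def algebra_simps)
  then show "e12 ((P \<odot> Q) \<odot> Q) = mat2_tr Q * e12 (P \<odot> Q) - e12 P"
    and "mat2_tr ((P \<odot> Q) \<odot> Q) = mat2_tr Q * mat2_tr (P \<odot> Q) - mat2_tr P"
    by (simp_all only: assms mult_1)
qed

text \<open>At the root the upper right entries of \<open>P\<close>, \<open>P \<odot> Q\<close>,
  \<open>Q\<close> are x, (x^2 + y^2) / z and y: the triple in which z has been replaced. Both root
  matrices have determinant 1 and entries without subtraction.\<close>

inductive cohn_pair :: "'a::field \<Rightarrow> 'a \<Rightarrow> 'a \<Rightarrow> 'a mat2 \<Rightarrow> 'a mat2 \<Rightarrow> bool" for x y z where
  root: "cohn_pair x y z (Mat (y / z) x (x / z\<^sup>2) ((x\<^sup>2 + z\<^sup>2) / (y * z)))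
                         (Mat ((y\<^sup>2 + z\<^sup>2) / (x * z)) y (y / z\<^sup>2) (x / z))"
| left: "cohn_pair x y z P Q \<Longrightarrow> cohn_pair x y z P (P \<odot> Q)"
| right: "cohn_pair x y z P Q \<Longrightarrow> cohn_pair x y z (P \<odot> Q) Q"

definition markoff_const :: "'a::field \<Rightarrow> 'a \<Rightarrow> 'a \<Rightarrow> 'a" where
  "markoff_const x y z = (x\<^sup>2 + y\<^sup>2 + z\<^sup>2) / (x * y * z)"

text \<open>Including the product \<open>P \<odot> Q\<close> closes the induction: trace and upper
  right entry of \<open>P \<odot> (P \<odot> Q)\<close> obey the same linear recursion with
  coefficient \<open>mat2_tr P\<close>, so proportionality with factor \<open>K\<close> passes to it
  from \<open>P \<odot> Q\<close> and \<open>Q\<close>. The other side is symmetric.\<close>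

lemma cohn_pair_trace:
  assumes "cohn_pair x y z P Q" "x \<noteq> 0" "y \<noteq> 0" "z \<noteq> 0"
  defines "K \<equiv> markoff_const x y z"
  shows "mat2_det P = 1 \<and> mat2_det Q = 1 \<and> mat2_tr P = K * e12 P \<and> mat2_tr Q = K * e12 Q \<and>
         mat2_tr (P \<odot> Q) = K * e12 (P \<odot> Q)"
  using assms(1)
proof induction
  case root
  show ?case
    using assms(2-4) unfolding K_def mat2_det_def mat2_tr_def markoff_const_def mat2_mult_simps mat2.sel
    by (intro conjI; simp add: divide_simps; algebra)
next
  case (left P Q)
  then show ?case
    by (simp add: mat2_det_mult mat2_square_mult_left algebra_simps del: mat2_mult_simps)
next
  case (right P Q)
  then show ?case
    by (simp add: mat2_det_mult mat2_square_mult_right algebra_simps del: mat2_mult_simps)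
qed

section \<open>Unordered triples and the operation on them\<close>

lemma markoff_const_mset_cong:
  assumes "{#x, y, z#} = {#x', y', z'#}"
  shows "markoff_const x y z = markoff_const x' y' z'"
proof -
  have "sum_mset (image_mset (\<lambda>t. t\<^sup>2) {#x, y, z#}) = sum_mset (image_mset (\<lambda>t. t\<^sup>2) {#x', y', z'#})"
    and "prod_mset {#x, y, z#} = prod_mset {#x', y', z'#}"
    using assms by (simp_all only:)
  then show ?thesis
    by (simp add: markoff_const_def add.assoc mult.assoc)
qed

text \<open>Multisets forget which component belongs to \<open>P\<close>, \<open>Q\<close> or the
  product. Letting p, q, r be any permutation of x, y, z makes the one root of
  \<open>cohn_pair\<close> serve for the replacement of each initial variable.\<close>

definition cohn_triple :: "'a::field \<Rightarrow> 'a \<Rightarrow> 'a \<Rightarrow> 'a multiset \<Rightarrow> bool" where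
  "cohn_triple x y z M \<longleftrightarrow> M = {#x, y, z#} \<or>
     (\<exists>p q r P Q. {#p, q, r#} = {#x, y, z#} \<and> cohn_pair p q r P Q \<and>
        M = {#e12 P, e12 (P \<odot> Q), e12 Q#})"

text \<open>Used to locate the entry being replaced. The other two stay an unordered pair, since the
  new entry depends only on their product.\<close>

lemma mset3_cases:
  assumes "{#u, v, w#} = {#a, b, c#}"
  obtains "w = a" "{#u, v#} = {#b, c#}" | "w = b" "{#u, v#} = {#a, c#}" | "w = c" "{#u, v#} = {#a, b#}"
proof -
  have eq: "add_mset w {#u, v#} = {#a, b, c#}"
    using assms by (simp add: add_mset_commute)
  then have "w \<in># {#a, b, c#}"
    by (metis union_single_eq_member)
  then consider "w = a" | "w = b" | "w = c"
    by auto
  then show ?thesis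
    using that eq by cases (simp_all add: add_mset_commute)
qed

lemma mset2_prod: "{#u, v#} = {#a, b#} \<Longrightarrow> u * v = a * (b::'a::comm_monoid_mult)"
  by (drule arg_cong[where f = prod_mset]) simp

text \<open>The operation is a move along an edge of the tree of triples: replacing the entry of
  \<open>P\<close> or \<open>Q\<close> leads to a child, replacing that of
  \<open>P \<odot> Q\<close> leads back to the parent.\<close>

lemma cohn_triple_flip:
  fixes x y z :: "'a::field"
  assumes "cohn_triple x y z {#u, v, w#}" and nz: "x \<noteq> 0" "y \<noteq> 0" "z \<noteq> 0"
  shows "cohn_triple x y z {#u, v, markoff_const x y z * u * v - w#}"
  using assms(1) unfolding cohn_triple_def[of x y z "{#u, v, w#}"]
proof (elim disjE exE conjE)
  assume eq: "{#u, v, w#} = {#x, y, z#}"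
  have "0 \<notin># {#u, v, w#}"
    unfolding eq using nz by simp
  then have nz': "u \<noteq> 0" "v \<noteq> 0" "w \<noteq> 0"
    by auto
  \<comment> \<open>The root pair for the order u, v, w, in which w is the variable
    replaced.\<close>
  let ?P = "Mat (v / w) u (u / w\<^sup>2) ((u\<^sup>2 + w\<^sup>2) / (v * w))"
  let ?Q = "Mat ((v\<^sup>2 + w\<^sup>2) / (u * w)) v (v / w\<^sup>2) (u / w)"
  have "e12 (?P \<odot> ?Q) = markoff_const u v w * u * v - w"
    using nz' by (simp add: markoff_const_def field_simps power2_eq_square)
  then have "{#u, v, markoff_const x y z * u * v - w#} = {#e12 ?P, e12 (?P \<odot> ?Q), e12 ?Q#}"
    unfolding markoff_const_mset_cong[OF eq] by (simp add: add_mset_commute)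
  then show ?thesis
    unfolding cohn_triple_def using eq cohn_pair.root[of u v w] by blast
next
  fix p q r P Q
  assume eq: "{#p, q, r#} = {#x, y, z#}" and PQ: "cohn_pair p q r P Q"
    and M: "{#u, v, w#} = {#e12 P, e12 (P \<odot> Q), e12 Q#}"
  have "0 \<notin># {#p, q, r#}"
    unfolding eq using nz by simp
  then have nz': "p \<noteq> 0" "q \<noteq> 0" "r \<noteq> 0"
    by auto
  define K where "K = markoff_const x y z"
  have K: "K = markoff_const p q r"
    using markoff_const_mset_cong[OF eq] by (simp add: K_def)
  note tr = cohn_pair_trace[OF PQ nz', folded K]
  have intro: "cohn_triple x y z N"
    if "cohn_pair p q r P' Q'" "N = {#e12 P', e12 (P' \<odot> Q'), e12 Q'#}" for P' Q' N
    using that eq unfolding cohn_triple_def by blast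
  from M have "cohn_triple x y z {#u, v, K * (u * v) - w#}"
  proof (cases rule: mset3_cases)
    case 1
    \<comment> \<open>The entry of \<open>P\<close> is replaced, so the new pair is
      \<open>P \<odot> Q\<close>, \<open>Q\<close>.\<close>
    have "e12 ((P \<odot> Q) \<odot> Q) = K * (u * v) - w"
      using tr 1(1) unfolding mset2_prod[OF 1(2)]
      by (simp add: mat2_square_mult_right del: mat2_mult_simps)
    then show ?thesis
      using 1(2) by (intro intro[OF cohn_pair.right[OF PQ]]) (simp add: add_mset_commute del: mat2_mult_simps)
  next
    case 2
    let ?N = "{#u, v, K * (u * v) - w#}"
    have N: "?N = {#e12 P, e12 Q, K * (e12 P * e12 Q) - e12 (P \<odot> Q)#}"
      unfolding mset2_prod[OF 2(2)] using 2
      by (metis add_mset_commute)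
    from PQ show ?thesis
    proof cases
      case root
      \<comment> \<open>At the root the backward move restores the replaced variable r, hence the
        initial triple.\<close>
      have "K * (e12 P * e12 Q) - e12 (P \<odot> Q) = r" "e12 P = p" "e12 Q = q"
        unfolding K root using nz' by (simp_all add: markoff_const_def field_simps power2_eq_square)
      then show ?thesis
        unfolding N cohn_triple_def using eq by simp
    next
      case (left Q')
      note tr' = cohn_pair_trace[OF left(2) nz', folded K]
      \<comment> \<open>Here \<open>Q\<close> is \<open>P \<odot> Q'\<close>, and the recursion read
        backwards recovers the entry of \<open>Q'\<close>.\<close>
      have "K * (e12 P * e12 Q) - e12 (P \<odot> Q) = e12 Q'"
        using tr' unfolding left(1) by (simp add: mat2_square_mult_left del: mat2_mult_simps)
      from N[unfolded this] show ?thesis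
        by (intro intro[OF left(2)]) (simp only: left(1))
    next
      case (right P')
      note tr' = cohn_pair_trace[OF right(2) nz', folded K]
      have "K * (e12 P * e12 Q) - e12 (P \<odot> Q) = e12 P'"
        using tr' unfolding right(1) by (simp add: mat2_square_mult_right del: mat2_mult_simps)
      from N[unfolded this] show ?thesis
        by (intro intro[OF right(2)]) (simp only: right(1) add_mset_commute)
    qed
  next
    case 3
    have "e12 (P \<odot> (P \<odot> Q)) = K * (u * v) - w"
      using tr 3(1) unfolding mset2_prod[OF 3(2)]
      by (simp add: mat2_square_mult_left del: mat2_mult_simps)
    then show ?thesis
      using 3(2) by (intro intro[OF cohn_pair.left[OF PQ]]) (simp add: add_mset_commute del: mat2_mult_simps)
  qed
  then show ?thesis
    by (simp add: K_def mult.assoc)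
qed

section \<open>Closure properties of Laurent polynomials with positive coefficients\<close>

lemma ratconst_add: "ratconst (a + b) = ratconst a + ratconst b"
  by (simp add: ratconst_def)

lemma ratconst_mult: "ratconst (a * b) = ratconst a * ratconst b"
  by (simp add: ratconst_def mult.commute)

lemma ratconst_0 [simp]: "ratconst 0 = 0"
  by (simp add: ratconst_def fract_collapse)

lemma ratconst_1 [simp]: "ratconst 1 = 1"
  by (simp add: ratconst_def fract_collapse flip: one_pCons)

text \<open>Polynomials are ordered by the sign of the leading coefficient, and fractions
  accordingly. Positivity later keeps all denominators non-zero.\<close>

lemma vars_pos:
  "(var_x :: 'a::linordered_field ratfun) > 0" "(var_y :: 'a ratfun) > 0" "(var_z :: 'a ratfun) > 0"
  unfolding var_x_def var_y_def var_z_def Fraction_Field.zero_less_Fract_iff[OF zero_less_one]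
  by (simp_all add: less_poly_def pos_poly_pCons one_pCons)

lemma laurent_monomial_add:
  "laurent_monomial (m + n) = laurent_monomial m * (laurent_monomial n :: 'a::linordered_field ratfun)"
  using vars_pos[where ?'a = 'a]
  by (cases m; cases n) (simp add: laurent_monomial_def power_int_add mult_ac)

lemma positive_laurent_term:
  assumes "c \<ge> 0"
  shows "positive_laurent (ratconst c * laurent_monomial m)"
  unfolding positive_laurent_def using assms by (intro exI[of _ "{m}"] exI[of _ "\<lambda>_. c"]) auto

lemma positive_laurent_add:
  fixes f g :: "'a::linordered_field ratfun"
  assumes "positive_laurent f" "positive_laurent g"
  shows "positive_laurent (f + g)"
proof -
  from assms(1) obtain S k where fin_S: "finite S" and k: "\<forall>m\<in>S. k m \<noteq> 0 \<longrightarrow> k m > 0"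
    and f: "f = (\<Sum>m\<in>S. ratconst (k m) * laurent_monomial m)"
    unfolding positive_laurent_def by blast
  from assms(2) obtain T l where fin_T: "finite T" and l: "\<forall>m\<in>T. l m \<noteq> 0 \<longrightarrow> l m > 0"
    and g: "g = (\<Sum>m\<in>T. ratconst (l m) * laurent_monomial m)"
    unfolding positive_laurent_def by blast
  \<comment> \<open>Extending the coefficients by 0 puts both sums over
    \<open>S \<union> T\<close>.\<close>
  let ?k = "\<lambda>m. if m \<in> S then k m else 0" and ?l = "\<lambda>m. if m \<in> T then l m else 0"
  have "f = (\<Sum>m\<in>S \<union> T. ratconst (?k m) * laurent_monomial m)"
    unfolding f using fin_S fin_T by (intro sum.mono_neutral_cong_left) auto
  moreover have "g = (\<Sum>m\<in>S \<union> T. ratconst (?l m) * laurent_monomial m)"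
    unfolding g using fin_S fin_T by (intro sum.mono_neutral_cong_left) auto
  ultimately have "f + g = (\<Sum>m\<in>S \<union> T. ratconst (?k m + ?l m) * laurent_monomial m)"
    by (simp add: ratconst_add algebra_simps flip: sum.distrib)
  moreover have "?k m \<ge> 0" "?l m \<ge> 0" for m
    using k l by (auto simp: order_le_less)
  then have "\<forall>m. ?k m + ?l m \<noteq> 0 \<longrightarrow> ?k m + ?l m > 0"
    by (metis add_nonneg_nonneg order_le_less)
  ultimately show ?thesis
    unfolding positive_laurent_def using fin_S fin_T
    by (intro exI[of _ "S \<union> T"] exI[of _ "\<lambda>m. ?k m + ?l m"]) blast
qed

lemma positive_laurent_0: "positive_laurent 0"
  using positive_laurent_term[of 0] by simp

lemma positive_laurent_sum:
  "(\<And>i. i \<in> I \<Longrightarrow> positive_laurent (f i)) \<Longrightarrow> positive_laurent (sum f I)"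
  by (induction I rule: infinite_finite_induct) (auto intro: positive_laurent_add positive_laurent_0)

lemma positive_laurent_mult:
  fixes f g :: "'a::linordered_field ratfun"
  assumes "positive_laurent f" "positive_laurent g"
  shows "positive_laurent (f * g)"
proof -
  from assms(1) obtain S k where k: "\<forall>m\<in>S. k m \<noteq> 0 \<longrightarrow> k m > 0"
    and f: "f = (\<Sum>m\<in>S. ratconst (k m) * laurent_monomial m)"
    unfolding positive_laurent_def by blast
  from assms(2) obtain T l where l: "\<forall>m\<in>T. l m \<noteq> 0 \<longrightarrow> l m > 0"
    and g: "g = (\<Sum>m\<in>T. ratconst (l m) * laurent_monomial m)"
    unfolding positive_laurent_def by blast
  \<comment> \<open>Different pairs may have the same \<open>m + n\<close>; instead of collecting
    them, each term is treated as a positive Laurent polynomial and closure under sums is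
    used.\<close>
  have "f * g = (\<Sum>m\<in>S. \<Sum>n\<in>T. ratconst (k m * l n) * laurent_monomial (m + n))"
    unfolding f g sum_product
    by (intro sum.cong refl) (simp only: ratconst_mult laurent_monomial_add mult_ac)
  moreover have "k m * l n \<ge> 0" if "m \<in> S" "n \<in> T" for m n
    using that k l by (intro mult_nonneg_nonneg) (auto simp: order_le_less)
  ultimately show ?thesis
    by (auto intro!: positive_laurent_sum positive_laurent_term)
qed

lemma positive_laurent_monomial: "positive_laurent (laurent_monomial m)"
  using positive_laurent_term[of 1 m] by simp

lemma positive_laurent_vars:
  fixes p :: "'a::linordered_field ratfun"
  assumes "p \<in> {var_x, var_y, var_z}"
  shows "positive_laurent p" "positive_laurent (inverse p)"
  using assms
    positive_laurent_monomial[of "(1, 0, 0)"] positive_laurent_monomial[of "(-1, 0, 0)"]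
    positive_laurent_monomial[of "(0, 1, 0)"] positive_laurent_monomial[of "(0, -1, 0)"]
    positive_laurent_monomial[of "(0, 0, 1)"] positive_laurent_monomial[of "(0, 0, -1)"]
  by (auto simp: laurent_monomial_def power_int_minus)

text \<open>The root entries and the matrix product use only sums, products and inverses of
  variables. This avoids the subtraction in K Y Z - X.\<close>

lemma cohn_pair_positive_laurent:
  fixes p q r :: "'a::linordered_field ratfun"
  assumes "cohn_pair p q r P Q" and vars: "{p, q, r} \<subseteq> {var_x, var_y, var_z}"
  shows "positive_laurent (e11 P) \<and> positive_laurent (e12 P) \<and>
         positive_laurent (e21 P) \<and> positive_laurent (e22 P) \<and>
         positive_laurent (e11 Q) \<and> positive_laurent (e12 Q) \<and>
         positive_laurent (e21 Q) \<and> positive_laurent (e22 Q)"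
  using assms(1)
proof induction
  case root
  have "positive_laurent t \<and> positive_laurent (inverse t)" if "t \<in> {p, q, r}" for t
    using that vars positive_laurent_vars by blast
  then show ?case
    by (auto simp: divide_inverse power2_eq_square intro!: positive_laurent_add positive_laurent_mult)
qed (auto intro!: positive_laurent_add positive_laurent_mult)

lemma cohn_triple_positive_laurent:
  assumes "cohn_triple var_x var_y var_z M" "f \<in># M"
  shows "positive_laurent f"
  using assms(1) unfolding cohn_triple_def
proof (elim disjE exE conjE)
  assume "M = {#var_x, var_y, var_z#}"
  then show ?thesis
    using assms(2) positive_laurent_vars(1)[of f] by auto
next
  fix p q r P Q
  assume eq: "{#p, q, r#} = {#var_x, var_y, var_z#}" and PQ: "cohn_pair p q r P Q"
    and M: "M = {#e12 P, e12 (P \<odot> Q), e12 Q#}"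
  have "set_mset {#p, q, r#} = set_mset {#var_x, var_y, var_z#}"
    using eq by (simp only:)
  then have "{p, q, r} \<subseteq> {var_x, var_y, var_z}"
    by simp
  from cohn_pair_positive_laurent[OF PQ this] show ?thesis
    using assms(2) M by (auto intro!: positive_laurent_add positive_laurent_mult)
qed

section \<open>The Markoff-type equation along the given operations\<close>

lemma markoff_equation_flip:
  fixes K :: "'a::linordered_field"
  assumes "X > 0" "Y > 0" "Z > 0" "X\<^sup>2 + Y\<^sup>2 + Z\<^sup>2 = K * X * Y * Z"
  defines "W \<equiv> (Y\<^sup>2 + Z\<^sup>2) / X"
  shows "W > 0" "W = K * Y * Z - X" "W\<^sup>2 + Y\<^sup>2 + Z\<^sup>2 = K * W * Y * Z"
proof -
  \<comment> \<open>A sum of squares of positive elements is positive, so the next operation never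
    divides by 0.\<close>
  show "W > 0"
    using assms by (simp add: W_def add_pos_pos)
  \<comment> \<open>Vieta: \<open>X\<close> and \<open>W\<close> are the roots of t^2 - K Y Z t +
    Y^2 + Z^2, with product Y^2 + Z^2 and sum K Y Z.\<close>
  show W: "W = K * Y * Z - X"
    using assms by (simp add: W_def field_simps power2_eq_square)
  show "W\<^sup>2 + Y\<^sup>2 + Z\<^sup>2 = K * W * Y * Z"
    using assms(4) unfolding W by algebra
qed

lemma markoff_triple_invariant:
  fixes X Y Z :: "'a::linordered_field ratfun"
  assumes "markoff_triple X Y Z"
  defines "K \<equiv> markoff_const var_x var_y (var_z :: 'a ratfun)"
  shows "X > 0 \<and> Y > 0 \<and> Z > 0 \<and> X\<^sup>2 + Y\<^sup>2 + Z\<^sup>2 = K * X * Y * Z \<and>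
         cohn_triple var_x var_y var_z {#X, Y, Z#}"
  using assms(1)
proof induction
  case initial
  then show ?case
    using vars_pos[where ?'a = 'a] by (simp add: K_def markoff_const_def cohn_triple_def)
next
  case (step_X X Y Z)
  note flip = markoff_equation_flip[of X Y Z K]
  \<comment> \<open>The component to be replaced is moved to the last place, as
    \<open>cohn_triple_flip\<close> expects.\<close>
  have "cohn_triple var_x var_y var_z {#Y, Z, X#}"
    using step_X.IH by (simp add: add_mset_commute)
  from cohn_triple_flip[OF this] step_X.IH show ?case
    using vars_pos[where ?'a = 'a] flip by (simp add: add_mset_commute K_def)
next
  case (step_Y X Y Z)
  note flip = markoff_equation_flip[of Y X Z K]
  have "cohn_triple var_x var_y var_z {#X, Z, Y#}"
    using step_Y.IH by (simp add: add_mset_commute)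
  from cohn_triple_flip[OF this] step_Y.IH show ?case
    using vars_pos[where ?'a = 'a] flip by (simp add: add_mset_commute K_def ac_simps)
next
  case (step_Z X Y Z)
  note flip = markoff_equation_flip[of Z X Y K]
  from step_Z.IH cohn_triple_flip[of var_x var_y var_z X Y Z] show ?case
    using vars_pos[where ?'a = 'a] flip by (simp add: K_def ac_simps)
qed

theorem theorem7p2:
  fixes X Y Z f :: "'a::linordered_field ratfun"
  assumes "markoff_triple X Y Z"
    and "f \<in> {X, Y, Z}"
  shows "positive_laurent f"
  using markoff_triple_invariant[OF assms(1)] assms(2)
  by (intro cohn_triple_positive_laurent[of "{#X, Y, Z#}"]) auto

end
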